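(* For every constant $\alpha>\frac{3\sqrt{6}}{8}$ there exists a constant $C$ such that the following holds. Let $G$ be a (simple) graph on $n$ vertices, and let the edges of $G$ be colored with $\alpha n$ colors so that each color class is a matching consisting of exactly $2$ edges. Then the rainbow girth of $G$ is at most $C\log n$; that is, $G$ contains a cycle of length at most $C\log n$ whose edges all have distinct colors.
   Context: An edge coloring need not be proper. A subgraph is rainbow if its edges have pairwise distinct colors; the rainbow girth is the minimum length of a rainbow cycle. Logarithms are base $2$. *)

theory Defs
  imports Complex_Main "HOL-Library.Extended_Real"
begin

definition simple_graph :: "'a set \<Rightarrow> 'a set set \<Rightarrow> bool" where
  "simple_graph V E \<longleftrightarrow> finite V \<and> (\<forall>e\<in>E. e \<subseteq> V \<and> card e = 2)"

definition matching :: "'a set set \<Rightarrow> bool" where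
  "matching M \<longleftrightarrow> (\<forall>e\<in>M. \<forall>f\<in>M. e \<noteq> f \<longrightarrow> e \<inter> f = {})"

definition color_class :: "'a set set \<Rightarrow> ('a set \<Rightarrow> 'c) \<Rightarrow> 'c \<Rightarrow> 'a set set" where
  "color_class E c k = {e \<in> E. c e = k}"

text \<open>A cycle is represented by the list of its vertices in cyclic order; the first vertex is
  not repeated at the end, so the length of the cycle is the length of the list.\<close>

definition cycle_edges :: "'a list \<Rightarrow> 'a set set" where
  "cycle_edges vs = {{vs ! i, vs ! (Suc i mod length vs)} | i. i < length vs}"

definition is_cycle :: "'a set set \<Rightarrow> 'a list \<Rightarrow> bool" where
  "is_cycle E vs \<longleftrightarrow> 3 \<le> length vs \<and> distinct vs \<and> cycle_edges vs \<subseteq> E"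

definition rainbow :: "('a set \<Rightarrow> 'c) \<Rightarrow> 'a set set \<Rightarrow> bool" where
  "rainbow c F \<longleftrightarrow> inj_on c F"

text \<open>The infimum is taken in the extended naturals, so the rainbow girth is \<open>\<infinity>\<close> when there is no
  rainbow cycle.\<close>

definition rainbow_girth :: "'a set set \<Rightarrow> ('a set \<Rightarrow> 'c) \<Rightarrow> enat" where
  "rainbow_girth E c =
     Inf {enat (length vs) | vs. is_cycle E vs \<and> rainbow c (cycle_edges vs)}"

lemma rainbow_girth_le_iff:
  "ereal_of_enat (rainbow_girth E c) \<le> ereal x \<longleftrightarrow>
     (\<exists>vs. is_cycle E vs \<and> rainbow c (cycle_edges vs) \<and> real (length vs) \<le> x)"
proof
  let ?S = "{enat (length vs) | vs. is_cycle E vs \<and> rainbow c (cycle_edges vs)}"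
  assume le: "ereal_of_enat (rainbow_girth E c) \<le> ereal x"
  then have "?S \<noteq> {}"
    by (auto simp: rainbow_girth_def Inf_enat_def split: if_splits)
  then have "rainbow_girth E c \<in> ?S"
    unfolding rainbow_girth_def Inf_enat_def by (simp only: if_False) (metis (lifting) LeastI_ex all_not_in_conv)
  with le show "\<exists>vs. is_cycle E vs \<and> rainbow c (cycle_edges vs) \<and> real (length vs) \<le> x"
    by auto
next
  assume "\<exists>vs. is_cycle E vs \<and> rainbow c (cycle_edges vs) \<and> real (length vs) \<le> x"
  then obtain vs where vs: "is_cycle E vs" "rainbow c (cycle_edges vs)" "real (length vs) \<le> x"
    by blast
  then have "rainbow_girth E c \<le> enat (length vs)"
    unfolding rainbow_girth_def by (intro Inf_lower) auto
  then have "ereal_of_enat (rainbow_girth E c) \<le> ereal_of_enat (enat (length vs))"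
    by (simp only: ereal_of_enat_le_iff)
  also have "\<dots> \<le> ereal x" using vs(3) by simp
  finally show "ereal_of_enat (rainbow_girth E c) \<le> ereal x" .
qed

end

theory Submission imports Defs begin

text \<open>Keep each vertex independently with probability \<open>p = sqrt 6 / 3\<close>. A color survives with probability
  \<open>2 p\<^sup>2 - p ^ 4 = 8 / 9\<close>, and \<open>3 * sqrt 6 / 8\<close> is exactly \<open>p / (8 / 9)\<close>; hence some vertex set \<open>S\<close> spans
  edges of more than \<open>q |S|\<close> colors, for some \<open>q > 1\<close>. One edge of each of these colors gives a
  rainbow graph on \<open>S\<close>. In a minimal subgraph with at least \<open>q\<close> times as many edges as vertices, at
  least \<open>q |W|\<close> edges meet each vertex set \<open>W\<close>. So as long as the balls around a vertex
  span trees, their sizes grow by a factor \<open>q\<close>, which can last only for logarithmically many steps;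
  and a ball that does not span a tree contains a cycle of length at most twice its radius plus one.\<close>

section \<open>Short cycles from a rooted tree and one further edge\<close>

lemma cycle_edges_subsetI:
  assumes "vs \<noteq> []" and "successively (\<lambda>x y. {x, y} \<in> E) vs" and "{last vs, hd vs} \<in> E"
  shows "cycle_edges vs \<subseteq> E"
proof
  fix e assume "e \<in> cycle_edges vs"
  then obtain i where i: "i < length vs" "e = {vs ! i, vs ! (Suc i mod length vs)}"
    unfolding cycle_edges_def by auto
  show "e \<in> E"
  proof (cases "Suc i < length vs")
    case True
    then show ?thesis using i assms(2) by (simp add: successively_conv_nth)
  next
    case False
    then have "Suc i = length vs" using i by simp
    moreover from this have "i = length vs - 1" by simp
    ultimately show ?thesis using i assms by (simp add: last_conv_nth hd_conv_nth)
  qed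
qed

text \<open>Induction on \<open>d u + d v\<close>, replacing the deeper endpoint by its parent. The
  bound on the depths of inner vertices strengthens the induction: it shows that the replaced
  endpoint is not yet on the path, so the path stays \<open>distinct\<close>.\<close>

lemma tree_path_exists:
  fixes d :: "'a \<Rightarrow> nat" and p :: "'a \<Rightarrow> 'a"
  assumes parent: "\<And>x. x \<in> B \<Longrightarrow> x \<noteq> s \<Longrightarrow> p x \<in> B \<and> d (p x) < d x" and root: "d s = 0"
    and "u \<in> B" "v \<in> B"
  shows "\<exists>xs. xs \<noteq> [] \<and> hd xs = u \<and> last xs = v \<and> distinct xs \<and> length xs \<le> d u + d v + 1 \<and>
           successively (\<lambda>x y. {x, y} \<in> (\<lambda>x. {x, p x}) ` (B - {s})) xs \<and>
           (\<forall>w\<in>set xs. w = u \<or> w = v \<or> d w < max (d u) (d v))"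
    (is "\<exists>xs. ?P u v xs")
  using assms(3,4)
proof (induction "d u + d v" arbitrary: u v rule: less_induct)
  case less
  have climb: "\<exists>xs. ?P u' v' xs"
    if "u' \<in> B" "v' \<in> B" "d u' + d v' = d u + d v" "d v' \<le> d u'" "u' \<noteq> v'" for u' v'
  proof -
    \<comment> \<open>If the deeper endpoint were the root, the other would have depth 0 too; only
      the root has depth 0, as any other vertex has a parent of smaller depth.\<close>
    have "u' \<noteq> s"
    proof
      assume "u' = s"
      then have "d v' = 0" using that(4) root by simp
      then show False using parent[OF that(2)] that(5) \<open>u' = s\<close> by auto
    qed
    note pu = parent[OF \<open>u' \<in> B\<close> this]
    have "d (p u') + d v' < d u + d v" using pu that(3) by linarith
    from less.hyps[OF this] obtain xs where xs: "?P (p u') v' xs" using pu \<open>v' \<in> B\<close> by blast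
    have "u' \<notin> set xs"
    proof
      assume "u' \<in> set xs"
      then have "u' = p u' \<or> u' = v' \<or> d u' < max (d (p u')) (d v')" using xs by blast
      then show False using pu that by auto
    qed
    moreover have "{u', p u'} \<in> (\<lambda>x. {x, p x}) ` (B - {s})" using that \<open>u' \<noteq> s\<close> by blast
    moreover have "\<forall>w\<in>set (u' # xs). w = u' \<or> w = v' \<or> d w < max (d u') (d v')"
    proof
      fix w assume "w \<in> set (u' # xs)"
      then consider "w = u'" | "w = p u'" | "w = v'" | "d w < max (d (p u')) (d v')" using xs by auto
      then show "w = u' \<or> w = v' \<or> d w < max (d u') (d v')" using pu by cases auto
    qed
    ultimately have "?P u' v' (u' # xs)" using xs pu by (simp add: successively_Cons del: set_simps)
    then show ?thesis by blast
  qed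
  show ?case
  proof (cases "u = v")
    case True
    then show ?thesis by (intro exI[of _ "[u]"]) simp
  next
    case False
    show ?thesis
    proof (cases "d v \<le> d u")
      case True
      with False less.prems climb show ?thesis by blast
    next
      case nle: False
      then obtain xs where "?P v u xs" using climb[of v u] False less.prems by auto
      then have "?P u v (rev xs)"
        by (auto simp: hd_rev last_rev insert_commute max.commute)
      then show ?thesis by blast
    qed
  qed
qed

text \<open>There are fewer than \<open>card B\<close> parent edges, so some edge of
  \<open>F\<close> inside \<open>B\<close> is not one of them. It closes the tree path between its
  ends to a cycle, and that path has at most \<open>d u + d v + 1\<close> vertices.\<close>

lemma short_cycle_if_not_tree:
  fixes d :: "'a \<Rightarrow> nat" and p :: "'a \<Rightarrow> 'a"
  assumes parent: "\<And>x. x \<in> B \<Longrightarrow> x \<noteq> s \<Longrightarrow> p x \<in> B \<and> d (p x) < d x \<and> {x, p x} \<in> F"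
    and root: "s \<in> B" "d s = 0" and depth: "\<And>x. x \<in> B \<Longrightarrow> d x \<le> r" and "finite B"
    and edges: "\<And>e. e \<in> F \<Longrightarrow> card e = 2"
    and many: "card B \<le> card {e \<in> F. e \<subseteq> B}"
  shows "\<exists>vs. is_cycle F vs \<and> length vs \<le> 2 * r + 1"
proof -
  let ?T = "(\<lambda>x. {x, p x}) ` (B - {s})"
  have "card ?T \<le> card (B - {s})" using \<open>finite B\<close> by (intro card_image_le) simp
  also have "\<dots> < card B" using root \<open>finite B\<close> by (intro card_Diff1_less)
  finally have less: "card ?T < card {e \<in> F. e \<subseteq> B}" using many by simp
  have "\<not> {e \<in> F. e \<subseteq> B} \<subseteq> ?T"
  proof
    assume "{e \<in> F. e \<subseteq> B} \<subseteq> ?T"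
    from card_mono[OF _ this] less \<open>finite B\<close> show False by simp
  qed
  then obtain e where e: "e \<in> F" "e \<subseteq> B" "e \<notin> ?T" by blast
  then obtain u v where uv: "e = {u, v}" "u \<noteq> v" using edges by (meson card_2_iff)
  have uvB: "u \<in> B" "v \<in> B" using e uv by auto
  obtain xs where xs: "xs \<noteq> []" "hd xs = u" "last xs = v" "distinct xs" "length xs \<le> d u + d v + 1"
    "successively (\<lambda>x y. {x, y} \<in> ?T) xs"
    using tree_path_exists[of B s p d, OF _ root(2) uvB] parent by blast
  \<comment> \<open>A path with one vertex would force \<open>u = v\<close>; one with two vertices
    would make \<open>e\<close> a parent edge.\<close>
  have "3 \<le> length xs"
  proof (rule ccontr)
    assume "\<not> 3 \<le> length xs"
    then consider a where "xs = [a]" | a b where "xs = [a, b]"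
      using xs(1) by (cases xs rule: remdups_adj.cases) (auto simp: Suc_le_eq)
    then show False using xs uv e(3) by cases auto
  qed
  moreover have "cycle_edges xs \<subseteq> F"
  proof (rule cycle_edges_subsetI)
    show "successively (\<lambda>x y. {x, y} \<in> F) xs"
    proof (rule successively_mono[OF xs(6)])
      have "?T \<subseteq> F" using parent by blast
      then show "{x, y} \<in> F" if "{x, y} \<in> ?T" for x y using that by blast
    qed
    show "{last xs, hd xs} \<in> F" using xs e uv by (simp add: insert_commute)
  qed fact
  moreover have "length xs \<le> 2 * r + 1" using xs(5) depth[OF uvB(1)] depth[OF uvB(2)] by simp
  ultimately show ?thesis unfolding is_cycle_def using xs(4) by blast
qed

text \<open>Since \<open>W\<close> itself is included, iterating \<open>r\<close> times from
  \<open>{s}\<close> gives the ball of radius \<open>r\<close> around \<open>s\<close>.\<close>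

definition neighbourhood :: "'a set set \<Rightarrow> 'a set \<Rightarrow> 'a set" where
  "neighbourhood F W = W \<union> {y. \<exists>x\<in>W. {x, y} \<in> F}"

text \<open>Breadth-first search supplies the rooted tree: depth is the distance \<open>d\<close>
  from \<open>s\<close>, and a vertex that enters at radius \<open>Suc k\<close> has a neighbour in
  the ball of radius \<open>k\<close>, which serves as its parent.\<close>

lemma short_cycle_if_ball_not_tree:
  fixes F :: "'a set set"
  assumes edges: "\<And>e. e \<in> F \<Longrightarrow> card e = 2"
    and fin: "finite ((neighbourhood F ^^ r) {s})"
    and many: "card ((neighbourhood F ^^ r) {s}) \<le> card {e \<in> F. e \<subseteq> (neighbourhood F ^^ r) {s}}"
  shows "\<exists>vs. is_cycle F vs \<and> length vs \<le> 2 * r + 1"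
proof -
  let ?B = "\<lambda>i. (neighbourhood F ^^ i) {s}"
  define d where "d x = (LEAST i. x \<in> ?B i)" for x
  have mono: "?B i \<subseteq> ?B j" if "i \<le> j" for i j
    using that by (induction rule: dec_induct) (auto simp: neighbourhood_def)
  have d_le: "d x \<le> i" if "x \<in> ?B i" for x i
    unfolding d_def using that by (rule Least_le)
  have in_d: "x \<in> ?B (d x)" if "x \<in> ?B i" for x i
    unfolding d_def using that by (rule LeastI)
  have parent: "\<exists>y. y \<in> ?B r \<and> d y < d x \<and> {x, y} \<in> F" if x: "x \<in> ?B r" "x \<noteq> s" for x
  proof -
    have "d x \<noteq> 0" using in_d[OF x(1)] x(2) by (cases "d x") auto
    then obtain k where k: "d x = Suc k" by (cases "d x") auto
    have "x \<notin> ?B k" using d_le[of x k] k by auto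
    then obtain y where y: "y \<in> ?B k" "{y, x} \<in> F"
      using in_d[OF x(1)] k by (auto simp: neighbourhood_def)
    have "d y < d x" using d_le[OF y(1)] k by simp
    moreover have "k \<le> r" using d_le[OF x(1)] k by simp
    ultimately show ?thesis using y mono[of k r] by (auto simp: insert_commute)
  qed
  then obtain p where "\<And>x. x \<in> ?B r \<Longrightarrow> x \<noteq> s \<Longrightarrow> p x \<in> ?B r \<and> d (p x) < d x \<and> {x, p x} \<in> F"
    by metis
  moreover have "s \<in> ?B r" using mono[of 0 r] by auto
  moreover have "d s = 0" using d_le[of s 0] by simp
  ultimately show ?thesis using short_cycle_if_not_tree[of "?B r" s p d F r] d_le fin edges many by blast
qed

section \<open>Logarithmic cycles in dense graphs\<close>

text \<open>\<open>U\<close> has least cardinality among the nonempty sets that span at least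
  \<open>q\<close> times as many edges as vertices. Deleting \<open>W\<close> leaves at most
  \<open>q * card (U - W)\<close> edges, so the edges lost, those meeting \<open>W\<close>, number
  at least \<open>q * card W\<close>.\<close>

lemma dense_core:
  fixes q :: real
  assumes "finite S" "S \<noteq> {}" and edges: "\<And>e. e \<in> F \<Longrightarrow> e \<subseteq> S \<and> card e = 2"
    and dense: "q * card S \<le> card F"
  obtains U where "U \<subseteq> S" "U \<noteq> {}"
    "\<forall>W\<subseteq>U. W \<noteq> {} \<longrightarrow> q * card W \<le> card {e \<in> F. e \<subseteq> U \<and> e \<inter> W \<noteq> {}}"
proof -
  have "F \<subseteq> Pow S" using edges by auto
  then have finF: "finite F" using \<open>finite S\<close> by (simp add: finite_subset)
  let ?Q = "\<lambda>U. U \<subseteq> S \<and> U \<noteq> {} \<and> q * card U \<le> card {e \<in> F. e \<subseteq> U}"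
  have "{e \<in> F. e \<subseteq> S} = F" using edges by auto
  then have "?Q S" using assms by simp
  then obtain U where U: "?Q U" and min: "\<And>U'. ?Q U' \<Longrightarrow> card U \<le> card U'"
    using ex_has_least_nat[of ?Q S card] by blast
  have finU: "finite U" using U \<open>finite S\<close> finite_subset by blast
  have "q * card W \<le> card {e \<in> F. e \<subseteq> U \<and> e \<inter> W \<noteq> {}}" if W: "W \<subseteq> U" "W \<noteq> {}" for W
  proof -
    have "{e \<in> F. e \<subseteq> U} = {e \<in> F. e \<subseteq> U - W} \<union> {e \<in> F. e \<subseteq> U \<and> e \<inter> W \<noteq> {}}" by auto
    then have "card {e \<in> F. e \<subseteq> U} \<le> card {e \<in> F. e \<subseteq> U - W} + card {e \<in> F. e \<subseteq> U \<and> e \<inter> W \<noteq> {}}"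
      by (metis (no_types, lifting) card_Un_le)
    moreover have "card {e \<in> F. e \<subseteq> U - W} \<le> q * card (U - W)"
    \<comment> \<open>Minimality concerns nonempty sets only; the empty set spans no edge because
      edges have two vertices.\<close>
    proof (cases "U - W = {}")
      case True
      have "{e \<in> F. e \<subseteq> U - W} = {}" unfolding True using edges by fastforce
      then show ?thesis unfolding True by simp
    next
      case False
      have "card (U - W) < card U" using W finU by (intro psubset_card_mono) auto
      then have "\<not> ?Q (U - W)" using min[of "U - W"] by auto
      then show ?thesis using False U by auto
    qed
    moreover have "real (card U) = card W + card (U - W)"
      using W finU by (metis card_Diff_subset card_mono finite_subset le_add_diff_inverse of_nat_add)
    ultimately show ?thesis using U by (simp add: algebra_simps)
  qed
  then show thesis using that U by blast
qed

lemma dense_graph_short_cycle: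
  fixes q :: real
  assumes q: "q > 1" and "finite S" "S \<noteq> {}" and edges: "\<And>e. e \<in> F \<Longrightarrow> e \<subseteq> S \<and> card e = 2"
    and dense: "q * card S \<le> card F" and R: "q ^ R > card S"
  shows "\<exists>vs. is_cycle F vs \<and> length vs \<le> 2 * R + 1"
proof -
  obtain U where U: "U \<subseteq> S" "U \<noteq> {}"
    and core: "\<forall>W\<subseteq>U. W \<noteq> {} \<longrightarrow> q * card W \<le> card {e \<in> F. e \<subseteq> U \<and> e \<inter> W \<noteq> {}}"
    by (rule dense_core[OF assms(2,3) edges dense])
  \<comment> \<open>Balls are taken in the graph induced on \<open>U\<close>, so they stay inside
    \<open>U\<close> and \<open>core\<close> applies to them.\<close>
  define F' where "F' = {e \<in> F. e \<subseteq> U}"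
  obtain s where s: "s \<in> U" using U by blast
  let ?B = "\<lambda>i. (neighbourhood F' ^^ i) {s}"
  have BU: "?B i \<subseteq> U" for i
    by (induction i) (use s in \<open>auto simp: neighbourhood_def F'_def\<close>)
  have finU: "finite U" using U \<open>finite S\<close> finite_subset by blast
  have finB: "finite (?B i)" for i using BU finU finite_subset by blast
  have sB: "s \<in> ?B i" for i
    by (induction i) (auto simp: neighbourhood_def)
  have finF: "finite {e \<in> F'. e \<subseteq> X}" for X
    by (rule finite_subset[of _ "Pow U"]) (auto simp: F'_def finU)
  have "\<exists>r\<le>R. card (?B r) \<le> card {e \<in> F'. e \<subseteq> ?B r}"
  proof (rule ccontr)
    assume "\<not> ?thesis"
    then have tree: "card {e \<in> F'. e \<subseteq> ?B r} < card (?B r)" if "r \<le> R" for r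
      using that by force
    have "q ^ i \<le> card (?B i)" if "i \<le> R" for i
      using that
    proof (induction i)
      case (Suc i)
      \<comment> \<open>The other end of an edge meeting a ball is at most one step away. Hence the
        at least \<open>q * card (?B i)\<close> edges meeting \<open>?B i\<close> lie in the next
        ball, which has more vertices than edges.\<close>
      have "{e \<in> F. e \<subseteq> U \<and> e \<inter> ?B i \<noteq> {}} \<subseteq> {e \<in> F'. e \<subseteq> ?B (Suc i)}"
      proof
        fix e assume e: "e \<in> {e \<in> F. e \<subseteq> U \<and> e \<inter> ?B i \<noteq> {}}"
        then obtain x where x: "x \<in> e" "x \<in> ?B i" by blast
        have "card e = 2" using e edges by blast
        then obtain y where "e = {x, y}" using x(1) by (auto simp: card_2_iff)
        then show "e \<in> {e \<in> F'. e \<subseteq> ?B (Suc i)}" using e x by (auto simp: F'_def neighbourhood_def)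
      qed
      from card_mono[OF finF this]
      have "card {e \<in> F. e \<subseteq> U \<and> e \<inter> ?B i \<noteq> {}} < card (?B (Suc i))"
        using tree[OF Suc.prems] by simp
      moreover have "q * card (?B i) \<le> card {e \<in> F. e \<subseteq> U \<and> e \<inter> ?B i \<noteq> {}}"
        using core BU[of i] sB[of i] by auto
      moreover have "q * q ^ i \<le> q * card (?B i)" using Suc q by simp
      ultimately show ?case by simp
    qed simp
    then have "q ^ R \<le> card (?B R)" by simp
    also have "card (?B R) \<le> card S" using BU U \<open>finite S\<close> by (meson card_mono order_trans)
    finally show False using R by simp
  qed
  then obtain r where r: "r \<le> R" "card (?B r) \<le> card {e \<in> F'. e \<subseteq> ?B r}" by blast
  have "\<exists>vs. is_cycle F' vs \<and> length vs \<le> 2 * r + 1"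
    by (rule short_cycle_if_ball_not_tree[OF _ finB r(2)]) (use edges F'_def in auto)
  then obtain vs where "is_cycle F' vs" "length vs \<le> 2 * r + 1" by blast
  moreover have "F' \<subseteq> F" unfolding F'_def by blast
  ultimately show ?thesis using r(1) unfolding is_cycle_def by (intro exI[of _ vs]) auto
qed

section \<open>Random vertex subsets and surviving colors\<close>

text \<open>For \<open>p\<close> in the unit interval this is the probability that a random subset
  of \<open>V\<close> contains \<open>A\<close>. The product of \<open>p + ?g x\<close> over
  \<open>V\<close> is expanded; as \<open>?g\<close> vanishes on \<open>A\<close>, only the sets
  \<open>S\<close> containing \<open>A\<close> contribute.\<close>

lemma sum_binomial_weights_superset:
  fixes p :: "'b :: comm_ring_1"
  assumes "finite V" "A \<subseteq> V"
  shows "(\<Sum>S\<in>Pow V. p ^ card S * (1 - p) ^ card (V - S) * of_bool (A \<subseteq> S)) = p ^ card A"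
proof -
  let ?g = "\<lambda>x. if x \<in> A then 0 else 1 - p"
  have "p ^ card A = (\<Prod>x\<in>V. if x \<in> A then p else 1)"
    using assms by (simp add: prod.If_cases Int_absorb1)
  also have "\<dots> = (\<Prod>x\<in>V. p + ?g x)" by (intro prod.cong) auto
  also have "\<dots> = (\<Sum>S\<in>Pow V. (\<Prod>x\<in>S. p) * (\<Prod>x\<in>V - S. ?g x))"
    by (rule prod_add[OF \<open>finite V\<close>])
  also have "\<dots> = (\<Sum>S\<in>Pow V. p ^ card S * (1 - p) ^ card (V - S) * of_bool (A \<subseteq> S))"
  proof (rule sum.cong[OF refl])
    fix S assume "S \<in> Pow V"
    have "(\<Prod>x\<in>V - S. ?g x) = (1 - p) ^ card (V - S) * of_bool (A \<subseteq> S)"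
    proof (cases "A \<subseteq> S")
      case True
      then have "(\<Prod>x\<in>V - S. ?g x) = (\<Prod>x\<in>V - S. 1 - p)" by (intro prod.cong) auto
      then show ?thesis using True by simp
    next
      case False
      then obtain a where "a \<in> A" "a \<in> V - S" using assms by blast
      then have "(\<Prod>x\<in>V - S. ?g x) = 0" using \<open>finite V\<close> by (intro prod_zero) auto
      then show ?thesis using False by simp
    qed
    then show "(\<Prod>x\<in>S. p) * (\<Prod>x\<in>V - S. ?g x) = p ^ card S * (1 - p) ^ card (V - S) * of_bool (A \<subseteq> S)"
      by (simp add: mult.assoc)
  qed
  finally show ?thesis by simp
qed

text \<open>First moment method: the two sides of \<open>less\<close> are \<open>q\<close> times the
  expected size of the random set and the expected number of colors it spans. If no \<open>S\<close>
  were good, averaging would reverse the inequality.\<close>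

lemma exists_subset_spanning_many_colors:
  fixes p q :: real
  assumes G: "simple_graph V E"
    and classes: "\<And>k. k \<in> c ` E \<Longrightarrow> matching (color_class E c k) \<and> card (color_class E c k) = 2"
    and p: "0 \<le> p" "p \<le> 1"
    and less: "q * p * card V < (2 * p ^ 2 - p ^ 4) * card (c ` E)"
  shows "\<exists>S\<subseteq>V. q * card S < card (c ` {e \<in> E. e \<subseteq> S})"
proof (rule ccontr)
  assume none: "\<not> ?thesis"
  have le: "card (c ` {e \<in> E. e \<subseteq> S}) \<le> q * card S" if "S \<subseteq> V" for S
    using that none by (meson not_less)
  define w where "w S = p ^ card S * (1 - p) ^ card (V - S)" for S
  have finV: "finite V" and edge: "\<And>e. e \<in> E \<Longrightarrow> e \<subseteq> V \<and> card e = 2"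
    using G unfolding simple_graph_def by auto
  have "E \<subseteq> Pow V" using edge by auto
  then have finE: "finite E" using finV by (simp add: finite_subset)
  have w: "(\<Sum>S\<in>Pow V. w S * of_bool (A \<subseteq> S)) = p ^ card A" if "A \<subseteq> V" for A
    unfolding w_def using sum_binomial_weights_superset[OF finV that] .
  \<comment> \<open>Survival probability of a color, by inclusion-exclusion over its two edges; both
    survive with probability \<open>p ^ 4\<close> because a matching makes their four ends
    distinct.\<close>
  have color: "(\<Sum>S\<in>Pow V. w S * of_bool (k \<in> c ` {e \<in> E. e \<subseteq> S})) = 2 * p ^ 2 - p ^ 4"
    if k: "k \<in> c ` E" for k
  proof -
    obtain e f where ef: "color_class E c k = {e, f}" "e \<noteq> f"
      using classes[OF k] by (meson card_2_iff)
    then have efE: "e \<in> E" "f \<in> E" unfolding color_class_def by auto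
    have "e \<inter> f = {}" using classes[OF k] ef unfolding matching_def by auto
    then have "card (e \<union> f) = 4"
      using edge[OF efE(1)] edge[OF efE(2)] finV by (metis card_Un_disjoint finite_subset numeral_Bit0)
    have k_iff: "k \<in> c ` {e \<in> E. e \<subseteq> S} \<longleftrightarrow> e \<subseteq> S \<or> f \<subseteq> S" for S
    proof -
      have "g \<in> E \<and> c g = k \<longleftrightarrow> g = e \<or> g = f" for g
        using ef(1) unfolding color_class_def by (simp add: set_eq_iff)
      then show ?thesis by (auto simp: image_iff) metis+
    qed
    have "(\<Sum>S\<in>Pow V. w S * of_bool (k \<in> c ` {e \<in> E. e \<subseteq> S})) =
        (\<Sum>S\<in>Pow V. w S * of_bool (e \<subseteq> S) + w S * of_bool (f \<subseteq> S) - w S * of_bool (e \<union> f \<subseteq> S))"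
      unfolding k_iff by (intro sum.cong) auto
    also have "\<dots> = p ^ card e + p ^ card f - p ^ card (e \<union> f)"
      using edge[OF efE(1)] edge[OF efE(2)] by (simp only: sum.distrib sum_subtractf w Un_least)
    finally show ?thesis using edge efE \<open>card (e \<union> f) = 4\<close> by simp
  qed
  have card_of_bool: "real (card (X \<inter> Y)) = (\<Sum>x\<in>Y. of_bool (x \<in> X))" if "finite Y" for X Y :: "'z set"
    using that by (simp add: Int_commute Int_def)
  have "(2 * p ^ 2 - p ^ 4) * card (c ` E) =
      (\<Sum>k\<in>c ` E. \<Sum>S\<in>Pow V. w S * of_bool (k \<in> c ` {e \<in> E. e \<subseteq> S}))"
    using color by simp
  also have "\<dots> = (\<Sum>S\<in>Pow V. \<Sum>k\<in>c ` E. w S * of_bool (k \<in> c ` {e \<in> E. e \<subseteq> S}))"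
    by (rule sum.swap)
  also have "\<dots> = (\<Sum>S\<in>Pow V. w S * card (c ` {e \<in> E. e \<subseteq> S}))"
  proof (rule sum.cong[OF refl])
    fix S
    have "c ` {e \<in> E. e \<subseteq> S} \<subseteq> c ` E" by auto
    then have "real (card (c ` {e \<in> E. e \<subseteq> S})) = (\<Sum>k\<in>c ` E. of_bool (k \<in> c ` {e \<in> E. e \<subseteq> S}))"
      using card_of_bool[of "c ` E" "c ` {e \<in> E. e \<subseteq> S}"] finE by (simp only: finite_imageI Int_absorb2)
    then show "(\<Sum>k\<in>c ` E. w S * of_bool (k \<in> c ` {e \<in> E. e \<subseteq> S})) = w S * card (c ` {e \<in> E. e \<subseteq> S})"
      by (simp only: sum_distrib_left)
  qed
  also have "\<dots> \<le> (\<Sum>S\<in>Pow V. w S * (q * card S))"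
    using le p by (intro sum_mono mult_left_mono) (auto simp: w_def)
  \<comment> \<open>Membership of \<open>v\<close> is written as inclusion of a singleton so that
    \<open>w\<close> evaluates the inner sum after the swap.\<close>
  also have "\<dots> = q * (\<Sum>S\<in>Pow V. \<Sum>v\<in>V. w S * of_bool ({v} \<subseteq> S))"
    unfolding sum_distrib_left
  proof (rule sum.cong[OF refl])
    fix S assume "S \<in> Pow V"
    then have "real (card S) = (\<Sum>v\<in>V. of_bool ({v} \<subseteq> S))"
      using card_of_bool[OF finV, of S] by (simp add: Int_absorb2)
    then show "w S * (q * card S) = (\<Sum>v\<in>V. q * (w S * of_bool ({v} \<subseteq> S)))"
      by (simp add: sum_distrib_left mult_ac)
  qed
  also have "\<dots> = q * (\<Sum>v\<in>V. \<Sum>S\<in>Pow V. w S * of_bool ({v} \<subseteq> S))"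
    by (subst sum.swap) rule
  also have "\<dots> = q * (\<Sum>v\<in>V. p)"
    by (intro arg_cong[where f = "(*) q"] sum.cong refl) (subst w, auto)
  finally show False using less by (simp add: mult_ac)
qed

section \<open>Rainbow cycles and the choice of constants\<close>

text \<open>With one edge \<open>F\<close> chosen per color spanned by \<open>S\<close>,
  \<open>c\<close> is injective on \<open>F\<close>, so every cycle in \<open>F\<close> is
  rainbow.\<close>

lemma rainbow_cycle_in_dense_spanned_colors:
  fixes q :: real
  assumes G: "simple_graph V E" and S: "S \<subseteq> V" and q: "q > 1"
    and dense: "q * card S < card (c ` {e \<in> E. e \<subseteq> S})" and R: "q ^ R > card V"
  shows "\<exists>vs. is_cycle E vs \<and> rainbow c (cycle_edges vs) \<and> length vs \<le> 2 * R + 1"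
proof -
  have finV: "finite V" and edge: "\<And>e. e \<in> E \<Longrightarrow> e \<subseteq> V \<and> card e = 2"
    using G unfolding simple_graph_def by auto
  obtain F where F: "F \<subseteq> {e \<in> E. e \<subseteq> S}" "inj_on c F" "c ` {e \<in> E. e \<subseteq> S} = c ` F"
    using iffD1[OF subset_image_inj subset_refl[of "c ` {e \<in> E. e \<subseteq> S}"]] by blast
  have "S \<noteq> {}"
  proof
    assume "S = {}"
    then have none: "{e \<in> E. e \<subseteq> S} = {}" using edge by fastforce
    show False using dense unfolding none by (simp add: \<open>S = {}\<close>)
  qed
  moreover have "q * card S \<le> card F" using dense F by (simp add: card_image)
  moreover have "card S < q ^ R" using R card_mono[OF finV S] by linarith
  moreover have "finite S" using finV S finite_subset by blast
  ultimately obtain vs where vs: "is_cycle F vs" "length vs \<le> 2 * R + 1"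
    using dense_graph_short_cycle[OF q, of S F R] F(1) edge by blast
  then have "is_cycle E vs" using F(1) unfolding is_cycle_def by blast
  moreover have "rainbow c (cycle_edges vs)"
    using vs F(2) unfolding is_cycle_def rainbow_def by (blast intro: inj_on_subset)
  ultimately show ?thesis using vs(2) by blast
qed

theorem theorem6:
  fixes \<alpha> :: real
  assumes "\<alpha> > 3 * sqrt 6 / 8"
  shows "\<exists>C :: real. \<forall>(V :: 'a set) (E :: 'a set set) (c :: 'a set \<Rightarrow> 'c) (n :: nat).
           simple_graph V E \<and> card V = n \<and> n \<ge> 1 \<and>
           int (card (c ` E)) = \<lceil>\<alpha> * real n\<rceil> \<and>
           (\<forall>k \<in> c ` E. matching (color_class E c k) \<and> card (color_class E c k) = 2)
           \<longrightarrow> ereal_of_enat (rainbow_girth E c) \<le> ereal (C * log 2 (real n))"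
proof -
  \<comment> \<open>This \<open>p\<close> minimises \<open>p / (2 * p ^ 2 - p ^ 4)\<close>, that is,
    maximises \<open>2 * p - p ^ 3\<close>: the derivative vanishes at
    \<open>p ^ 2 = 2 / 3\<close>.\<close>
  define p where "p = sqrt 6 / 3"
  have p2: "p ^ 2 = 2 / 3" unfolding p_def by (simp add: power_divide)
  have "p ^ 4 = (p ^ 2) ^ 2" by simp
  then have p4: "p ^ 4 = 4 / 9" by (simp only: p2) (simp add: power2_eq_square)
  have p_pos: "p > 0" unfolding p_def by simp
  have p_le: "p \<le> 1" by (rule power2_le_imp_le) (simp_all add: p2)
  have "8 / 9 * \<alpha> / p > 1" using assms p_pos unfolding p_def by (simp add: field_simps)
  then obtain q where q: "1 < q" "q < 8 / 9 * \<alpha> / p" using dense by blast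
  \<comment> \<open>The first term changes base \<open>q\<close> to base 2; the 3 absorbs the
    additive constant, since \<open>log 2 n\<close> is at least 1 once
    \<open>n \<ge> 2\<close>.\<close>
  define C where "C = 2 / log 2 q + 3"
  have "ereal_of_enat (rainbow_girth E c) \<le> ereal (C * log 2 (real n))"
    if G: "simple_graph V E" and n: "card V = n" "n \<ge> 1"
      and colors: "int (card (c ` E)) = \<lceil>\<alpha> * real n\<rceil>"
      and classes: "\<forall>k \<in> c ` E. matching (color_class E c k) \<and> card (color_class E c k) = 2"
    for V :: "'a set" and E :: "'a set set" and c :: "'a set \<Rightarrow> 'c" and n
  proof -
    have many: "\<alpha> * n \<le> card (c ` E)" using colors by linarith
    \<comment> \<open>A positive number of colors forces an edge, hence two vertices; this excludes
      \<open>n = 1\<close>, where the claimed bound would be 0.\<close>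
    have "\<alpha> > 0" using assms by (smt (verit) real_sqrt_ge_zero divide_nonneg_pos)
    then have "\<alpha> * n > 0" using n by simp
    then obtain e where "e \<in> E" using many by force
    then have "finite V" "e \<subseteq> V" "card e = 2" using G unfolding simple_graph_def by auto
    then have n2: "n \<ge> 2" using n card_mono by metis
    have "q * p * n < 8 / 9 * \<alpha> * n" using q p_pos n by (simp add: field_simps)
    also have "\<dots> \<le> 8 / 9 * card (c ` E)" using many by simp
    finally have "q * p * card V < (2 * p ^ 2 - p ^ 4) * card (c ` E)" by (simp add: p2 p4 n)
    then obtain S where S: "S \<subseteq> V" "q * card S < card (c ` {e \<in> E. e \<subseteq> S})"
      using exists_subset_spanning_many_colors[OF G, of c p q] classes p_pos p_le by auto
    \<comment> \<open>The added 1 makes \<open>R\<close> strictly larger than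
      \<open>log q n\<close>, as \<open>n < q ^ R\<close> is strict.\<close>
    define R where "R = nat \<lfloor>log q n\<rfloor> + 1"
    have log_nonneg: "log q n \<ge> 0" using q n by simp
    have "log q n < R" unfolding R_def using log_nonneg by linarith
    then have "n < q ^ R" using q n by (simp add: log_less_iff powr_realpow)
    with rainbow_cycle_in_dense_spanned_colors[OF G S(1) q(1) S(2)] n
    obtain vs where vs: "is_cycle E vs" "rainbow c (cycle_edges vs)" "length vs \<le> 2 * R + 1"
      by auto
    have "real (length vs) \<le> 2 * R + 1" using vs(3) by linarith
    also have "\<dots> \<le> 2 * log q n + 3" unfolding R_def using log_nonneg by simp
    also have "\<dots> = 2 / log 2 q * log 2 n + 3" by (simp add: log_def)
    also have "\<dots> \<le> 2 / log 2 q * log 2 n + 3 * log 2 n" using n2 by simp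
    also have "\<dots> = C * log 2 n" unfolding C_def by (simp add: algebra_simps)
    finally show ?thesis unfolding rainbow_girth_le_iff using vs by blast
  qed
  then show ?thesis by blast
qed

end
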